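(* For every $n\in\mathbb N=\{1,2,3,\dots\}$, $$\mathrm{IR}(\vec{\mathcal T}_{n+1})\le \mathrm{IR}(\vec{\mathcal T}_n)\big(\mathrm{IR}(\vec{\mathcal T}_n)+1\big)\quad\text{and}\quad \mathrm{IR}(\vec{\mathcal T}_n)<2^{2^{n-1}}.$$
   Context: Graphs are simple and undirected. A digraph has neither loops nor pairs of opposite arcs. An orientation $\vec G$ of a graph $G$ is a digraph on $V_G$ obtained by replacing each edge $\{a,b\}$ by exactly one of $(a,b)$, $(b,a)$. The distance $d_G(u,v)$ is the smallest number of edges of a path in $G$ joining $u$ and $v$ ($\infty$ if there is none); distance in a digraph is the distance in its underlying undirected graph. For a graph $G$ and a digraph $\vec H$, $G\Rightarrow\vec H$ means: for every orientation $\vec G$ of $G$ there is an injective map $f:V_{\vec H}\to V_G$ such that (i) for all $u,v\in V_{\vec H}$, $(u,v)\in E_{\vec H}$ if and only if $(f(u),f(v))\in E_{\vec G}$, and (ii) $d_{\vec H}(u,v)=d_G(f(u),f(v))$ for all $u,v\in V_{\vec H}$. For a class $\vec{\mathcal H}$ of digraphs, $G\Rightarrow\vec{\mathcal H}$ means $G\Rightarrow\vec H$ for every $\vec H\in\vec{\mathcal H}$, and $\mathrm{IR}(\vec{\mathcal H})$ is the smallest number of vertices of a graph $G$ with $G\Rightarrow\vec{\mathcal H}$. $\vec{\mathcal T}_n$ denotes the class of all oriented trees (orientations of trees) on $n$ vertices. *)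

theory Defs
  imports "Graph_Theory.Graph_Theory" "HOL-Library.Extended_Nat"
begin

text \<open>
  As in \<^verbatim>\<open>Graph_Theory\<close>, a finite simple undirected graph is a \<^const>\<open>pair_graph\<close>, i.e. a finite
  loop-free symmetric digraph: the edge \<open>{a,b}\<close> is the pair of arcs \<open>(a,b)\<close>, \<open>(b,a)\<close>.
  Finite digraphs without loops and opposite arcs are exactly the orientations of such graphs.
\<close>

definition orientation :: "'a pair_pre_digraph \<Rightarrow> 'a pair_pre_digraph \<Rightarrow> bool" where
  "orientation D G \<longleftrightarrow>
     pverts D = pverts G \<and> parcs D \<subseteq> parcs G \<and>
     (\<forall>a b. (a, b) \<in> parcs G \<longrightarrow> ((a, b) \<in> parcs D \<longleftrightarrow> (b, a) \<notin> parcs D))"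

text \<open>The infimum over the empty set is \<open>\<infinity>\<close>.\<close>

definition graph_dist :: "'a pair_pre_digraph \<Rightarrow> 'a \<Rightarrow> 'a \<Rightarrow> enat" where
  "graph_dist G u v = (INF p\<in>{p. pre_digraph.apath (with_proj G) u p v}. enat (length p))"

definition digraph_dist :: "'a pair_pre_digraph \<Rightarrow> 'a \<Rightarrow> 'a \<Rightarrow> enat" where
  "digraph_dist D = graph_dist (mk_symmetric (with_proj D))"

text \<open>
  The notion \<^const>\<open>tree\<close> of \<^verbatim>\<open>Graph_Theory\<close> excludes directed cycles only, and in a symmetric
  digraph it counts \<open>a, b, a\<close> as a cycle. A cycle of an undirected graph is a
  \<^const>\<open>pre_digraph.cycle\<close> of length at least 3.
\<close>

definition undirected_tree :: "'a pair_pre_digraph \<Rightarrow> bool" where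
  "undirected_tree T \<longleftrightarrow>
     pair_graph T \<and> Digraph_Component.connected (with_proj T) \<and>
     \<not> (\<exists>p. pre_digraph.cycle (with_proj T) p \<and> 3 \<le> length p)"

definition oriented_trees :: "nat \<Rightarrow> 'a pair_pre_digraph set" where
  "oriented_trees n = {H. card (pverts H) = n \<and> (\<exists>T. undirected_tree T \<and> orientation H T)}"

definition arrows :: "'a pair_pre_digraph \<Rightarrow> 'b pair_pre_digraph \<Rightarrow> bool" (infix \<open>\<Rrightarrow>\<close> 50) where
  "G \<Rrightarrow> H \<longleftrightarrow>
     (\<forall>D. orientation D G \<longrightarrow>
        (\<exists>f. f ` pverts H \<subseteq> pverts G \<and> inj_on f (pverts H) \<and>
             (\<forall>u\<in>pverts H. \<forall>v\<in>pverts H. (u, v) \<in> parcs H \<longleftrightarrow> (f u, f v) \<in> parcs D) \<and>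
             (\<forall>u\<in>pverts H. \<forall>v\<in>pverts H. digraph_dist H u v = graph_dist G (f u) (f v))))"

definition arrows_class :: "'a pair_pre_digraph \<Rightarrow> 'b pair_pre_digraph set \<Rightarrow> bool" where
  "arrows_class G \<H> \<longleftrightarrow> (\<forall>H\<in>\<H>. G \<Rrightarrow> H)"

text \<open>
  Every finite graph has an isomorphic copy with vertices in \<^typ>\<open>nat\<close>, so that type suffices, both
  for the graphs \<open>G\<close> and for the members of the class. If no graph is suitable, the value is \<open>\<infinity>\<close>;
  hence an upper bound by a finite number includes the existence of a suitable graph.
\<close>

definition IR :: "nat pair_pre_digraph set \<Rightarrow> enat" where
  "IR \<H> = (INF G\<in>{G :: nat pair_pre_digraph. pair_graph G \<and> arrows_class G \<H>}.
             enat (card (pverts G)))"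

lemma orientation_pair_digraph:
  assumes "pair_graph G" "orientation D G"
  shows "pair_digraph D" "antisym (parcs D)" "mk_symmetric (with_proj D) = G"
proof -
  interpret pair_graph G by fact
  have sym: "(b, a) \<in> parcs G" if "(a, b) \<in> parcs G" for a b
    using that pair_sym_arcs by (auto simp: symmetric_def dest: symD)
  have sub: "parcs D \<subseteq> parcs G" and verts: "pverts D = pverts G"
    using assms(2) by (auto simp: orientation_def)
  have ends: "a \<in> pverts G \<and> b \<in> pverts G \<and> a \<noteq> b" if "(a, b) \<in> parcs D" for a b
    using that sub in_arcsD1 in_arcsD2 pair_no_loops[of "(a, b)"] by auto
  show "pair_digraph D"
  proof
    show "finite (parcs D)"
      using sub pair_finite_arcs by (rule finite_subset)
  qed (use ends verts pair_finite_verts in auto)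
  show "antisym (parcs D)"
    using assms(2) sub by (auto simp: orientation_def intro!: antisymI)
  have "parcs (mk_symmetric (with_proj D)) = parcs G"
    using assms(2) sub sym by (fastforce simp: orientation_def parcs_mk_symmetric)
  then show "mk_symmetric (with_proj D) = G"
    using verts by (intro pair_pre_digraph.equality) auto
qed

end

(* Let G on N vertices be suitable for the trees on n vertices, and take the Cartesian product of
   G with the complete graph on N + 1 vertices. Remove a leaf l with neighbour v from a tree on
   n + 1 vertices. Given an orientation of the product, each of the N + 1 layers contains an
   isometric copy of the remaining tree, and two of these copies use the same vertex of G for v.
   Whichever way the edge between the two layers at this vertex is oriented, one of the two copies
   is extended by it with the required direction of the leaf arc. In both the tree and the product,
   leaving the leaf costs exactly one extra step, so the extended copy is again isometric. *)

theory Submission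
  imports Defs
begin

section \<open>Walks with idle steps and distances\<close>

lemma relpow_nonexpansive:
  assumes "(a, b) \<in> (R\<^sup>=) ^^ k" and "\<And>x y. (x, y) \<in> R \<Longrightarrow> (h x, h y) \<in> S\<^sup>="
  shows "(h a, h b) \<in> (S\<^sup>=) ^^ k"
  using assms(1)
proof (induction k arbitrary: b)
  case (Suc k)
  then obtain c where "(a, c) \<in> (R\<^sup>=) ^^ k" "(c, b) \<in> R\<^sup>=" by auto
  from Suc.IH[OF this(1)] have "(h a, h c) \<in> (S\<^sup>=) ^^ k" .
  moreover have "(h c, h b) \<in> S\<^sup>=" using \<open>(c, b) \<in> R\<^sup>=\<close> assms(2) by blast
  ultimately show ?case by (rule relpow_Suc_I)
qed auto

lemma relpow_reflcl_mono:
  assumes "(a, b) \<in> (R\<^sup>=) ^^ k" "k \<le> m"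
  shows "(a, b) \<in> (R\<^sup>=) ^^ m"
  using assms(2,1) by (induction rule: dec_induct) auto

lemma relpow_converseI:
  assumes "sym R" "(a, b) \<in> R ^^ k"
  shows "(b, a) \<in> R ^^ k"
  using assms(2)
proof (induction k arbitrary: b)
  case (Suc k)
  then obtain c where "(a, c) \<in> R ^^ k" "(c, b) \<in> R" by auto
  then show ?case using Suc.IH assms(1) by (meson relpow_Suc_I2 symD)
qed auto

text \<open>All equalities of distances are proved through finite upper bounds. This also covers
  infinite distances, since \<open>\<infinity>\<close> is the only value without a finite upper
  bound.\<close>

lemma enat_eqI:
  fixes a b :: enat
  assumes "\<And>k. a \<le> enat k \<longleftrightarrow> b \<le> enat k"
  shows "a = b"
  using assms by (metis antisym enat_ile linorder_linear enat_ord_code(3) not_infinity_eq)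

text \<open>Allowing idle steps replaces ``a path of length at most \<open>k\<close>'' by an exact power, which is
  preserved by maps that may contract edges.\<close>

lemma graph_dist_le_iff:
  assumes "pair_wf_digraph G" "u \<in> pverts G"
  shows "graph_dist G u v \<le> enat k \<longleftrightarrow> (u, v) \<in> ((parcs G)\<^sup>=) ^^ k"
proof
  interpret pair_wf_digraph G by fact
  assume "graph_dist G u v \<le> enat k"
  \<comment> \<open>A strict bound on the infimum yields a path as witness, with no need to show
    first that the infimum is attained.\<close>
  then have "graph_dist G u v < enat (Suc k)"
    using enat_ord_simps(2) lessI order_le_less_trans by blast
  then obtain p where p: "apath u p v" "length p \<le> k"
    by (auto simp: graph_dist_def INF_less_iff)
  have "(u, v) \<in> ((parcs G)\<^sup>=) ^^ length p"
    using awalkI_apath[OF p(1)]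
  proof (induction p arbitrary: u)
    case (Cons e p)
    then have "e \<in> parcs G" "u = fst e" "awalk (snd e) p v" by (auto simp: awalk_Cons_iff)
    then show ?case using Cons.IH[of "snd e"] relpow_Suc_I2[of u "snd e" "(parcs G)\<^sup>="] by simp
  qed (auto simp: awalk_Nil_iff)
  then show "(u, v) \<in> ((parcs G)\<^sup>=) ^^ k" using p(2) by (rule relpow_reflcl_mono)
next
  interpret pair_wf_digraph G by fact
  assume "(u, v) \<in> ((parcs G)\<^sup>=) ^^ k"
  then have "\<exists>p. awalk u p v \<and> length p \<le> k"
  proof (induction k arbitrary: v)
    case 0
    then show ?case using assms(2) by (auto simp: awalk_Nil_iff intro!: exI[of _ "[]"])
  next
    case (Suc k)
    then obtain w where "(u, w) \<in> ((parcs G)\<^sup>=) ^^ k" and wv: "(w, v) \<in> (parcs G)\<^sup>=" by auto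
    with Suc.IH obtain p where p: "awalk u p w" "length p \<le> k" by blast
    show ?case
    proof (cases "w = v")
      case False
      then have "awalk w [(w, v)] v" using wv arc_implies_awalk[of "(w, v)"] by simp
      then show ?thesis using p awalk_appendI by (intro exI[of _ "p @ [(w, v)]"]) auto
    qed (use p le_SucI in blast)
  qed
  then obtain p where p: "awalk u p v" "length p \<le> k" by blast
  \<comment> \<open>The arcs of the extracted path are distinct and all occur in \<open>p\<close>.
    Counting them therefore bounds its length by that of \<open>p\<close>.\<close>
  let ?q = "awalk_to_apath p"
  have q: "apath u ?q v" using p(1) by (rule apath_awalk_to_apath)
  then have "distinct ?q" by (auto simp: apath_def intro: distinct_verts_imp_distinct)
  then have "length ?q = card (set ?q)" by (simp add: distinct_card)
  also have "\<dots> \<le> card (set p)" using awalk_to_apath_subset[OF p(1)] by (simp add: card_mono)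
  also have "\<dots> \<le> k" using card_length p(2) le_trans by blast
  finally show "graph_dist G u v \<le> enat k"
    unfolding graph_dist_def using q by (intro INF_lower2[of ?q]) auto
qed

section \<open>Basic facts on graphs and orientations\<close>

lemma pair_graph_sym: "pair_graph G \<Longrightarrow> sym (parcs G)"
  using pair_sym_digraph.arcs_symmetric pair_graph.axioms(2) pair_pseudo_graph.axioms(2)
  by (metis symI)

lemma pair_graph_wf: "pair_graph G \<Longrightarrow> pair_wf_digraph G"
  by (simp add: pair_graph_def pair_digraph_def pair_fin_digraph_def)

lemma pair_graphI:
  assumes "finite (pverts G)" "parcs G \<subseteq> pverts G \<times> pverts G" "sym (parcs G)" "irrefl (parcs G)"
  shows "pair_graph G"
proof
  show "finite (parcs G)" using assms by (meson finite_SigmaI finite_subset)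
qed (use assms in \<open>auto simp: symmetric_def irrefl_def\<close>)

lemma orientation_parcsD: "orientation D G \<Longrightarrow> e \<in> parcs D \<Longrightarrow> e \<in> parcs G"
  by (auto simp: orientation_def)

lemma orientation_opposite:
  "orientation D G \<Longrightarrow> (a, b) \<in> parcs G \<Longrightarrow> (a, b) \<in> parcs D \<longleftrightarrow> (b, a) \<notin> parcs D"
  unfolding orientation_def by blast

text \<open>Since \<open>h\<close> preserves and reflects adjacency, each edge of \<open>G\<close>
  inherits exactly one direction from its image. This serves both for a single layer of a product
  and for a renaming of vertices.\<close>

lemma orientation_pullback:
  assumes "orientation D G'"
    and arcs: "\<And>x y. x \<in> pverts G \<Longrightarrow> y \<in> pverts G \<Longrightarrow> (h x, h y) \<in> parcs G' \<longleftrightarrow> (x, y) \<in> parcs G"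
    and "pair_wf_digraph G"
  shows "orientation \<lparr>pverts = pverts G,
    parcs = {(x, y). x \<in> pverts G \<and> y \<in> pverts G \<and> (h x, h y) \<in> parcs D}\<rparr> G"
proof -
  interpret pair_wf_digraph G by fact
  have "(x, y) \<in> parcs G" if "x \<in> pverts G" "y \<in> pverts G" "(h x, h y) \<in> parcs D" for x y
    using orientation_parcsD[OF assms(1) that(3)] arcs that by blast
  moreover have "(h a, h b) \<in> parcs D \<longleftrightarrow> (h b, h a) \<notin> parcs D" if "(a, b) \<in> parcs G" for a b
    using orientation_opposite[OF assms(1), of "h a" "h b"] arcs[of a b] that in_arcsD1 in_arcsD2 by blast
  ultimately show ?thesis
    unfolding orientation_def pair_pre_digraph.select_convs mem_Collect_eq case_prod_conv
    using in_arcsD1 in_arcsD2 by blast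
qed

lemma graph_dist_commute:
  assumes "pair_graph G" "u \<in> pverts G" "v \<in> pverts G"
  shows "graph_dist G u v = graph_dist G v u"
proof (rule enat_eqI)
  have "sym ((parcs G)\<^sup>=)" using pair_graph_sym[OF assms(1)] by (auto simp: sym_def)
  then show "graph_dist G u v \<le> enat k \<longleftrightarrow> graph_dist G v u \<le> enat k" for k
    using graph_dist_le_iff[OF pair_graph_wf[OF assms(1)]] assms(2,3) relpow_converseI by metis
qed

lemma graph_dist_refl:
  assumes "u \<in> pverts G"
  shows "graph_dist G u u = 0"
proof -
  have "pre_digraph.apath (with_proj G) u [] u"
    using assms by (simp add: pre_digraph.apath_def pre_digraph.awalk_def
        pre_digraph.awalk_verts.simps pre_digraph.cas.simps)
  then have "graph_dist G u u \<le> enat (length ([] :: ('a \<times> 'a) list))"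
    unfolding graph_dist_def by (intro INF_lower) simp
  then show ?thesis by (simp add: zero_enat_def[symmetric])
qed

section \<open>Leaves of trees\<close>

text \<open>The first vertex of a longest path is a leaf: a second neighbour would either prolong
  the path or lie on it and close a cycle.\<close>

lemma undirected_tree_leaf:
  assumes "undirected_tree T" "card (pverts T) \<ge> 2"
  obtains l v where "(l, v) \<in> parcs T" "\<And>x. (l, x) \<in> parcs T \<Longrightarrow> x = v"
proof -
  interpret pair_graph T using assms(1) by (simp add: undirected_tree_def)
  have conn: "Digraph_Component.connected (with_proj T)" and acyc: "\<And>p. cycle p \<Longrightarrow> length p < 3"
    using assms(1) by (auto simp: undirected_tree_def not_le[symmetric])
  obtain a b where ab: "a \<in> pverts T" "b \<in> pverts T" "a \<noteq> b"
    using assms(2) by (metis One_nat_def Suc_1 card_le_Suc0_iff_eq not_less_eq_eq pair_finite_verts)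
  have "strongly_connected (with_proj T)"
    using conn pair_sym_arcs by (rule symmetric_connected_imp_strongly_connected[rotated])
  then have "reachable (with_proj T) a b" using ab by (auto simp: strongly_connected_def)
  then obtain p where "apath a p b" by (auto simp: reachable_apath)
  moreover from this have "p \<noteq> []" using ab by (auto simp: apath_Nil_iff)
  \<comment> \<open>The number of vertices bounds the length of every path, so a longest one exists.
    It is nonempty because the path from \<open>a\<close> to \<open>b\<close> is.\<close>
  moreover have "\<forall>q. (\<exists>u w. apath u q w) \<longrightarrow> length q < Suc (card (pverts T))"
    using length_apath by (auto simp: less_Suc_eq_le)
  ultimately obtain m where m: "\<exists>u w. apath u m w" "\<And>q u w. apath u q w \<Longrightarrow> length q \<le> length m"
    using ex_has_greatest_nat[of "\<lambda>q. \<exists>u w. apath u q w" p length "Suc (card (pverts T))"] by blast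
  have "m \<noteq> []" using m(2)[OF \<open>apath a p b\<close>] \<open>p \<noteq> []\<close> by auto
  then obtain l v q w where path: "apath l ((l, v) # q) w" and m_eq: "m = (l, v) # q"
    using m(1) by (cases m) (auto simp: apath_Cons_iff)
  have lv: "(l, v) \<in> parcs T" using path by (simp add: apath_Cons_iff)
  have "x = v" if lx: "(l, x) \<in> parcs T" for x
  proof (rule ccontr)
    assume "x \<noteq> v"
    have xl: "(x, l) \<in> parcs T" using lx by (rule arcs_symmetric)
    have "x \<in> set (pawalk_verts l m)"
    proof (rule ccontr)
      assume "x \<notin> set (pawalk_verts l m)"
      then have "apath x ((x, l) # m) w" using path xl m_eq by (simp add: apath_Cons_iff)
      then show False using m(2) by fastforce
    qed
    moreover have aw: "awalk l m w" using path m_eq by (simp add: awalkI_apath)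
    ultimately obtain r s where rs: "m = r @ s" "awalk l r x" "awalk x s w"
      using awalk_decomp by blast
    have r: "apath l r x"
      using path rs m_eq awlast_if_cas by (metis apath_append_iff awalk_def)
    \<comment> \<open>\<open>r\<close> is the initial part of \<open>m\<close> that ends in
      \<open>x\<close>. If it had only one arc, this would be \<open>(l, v)\<close>, giving
      \<open>x = v\<close>. So \<open>r\<close> has at least two arcs, and the arc
      \<open>(x, l)\<close> completes it to a cycle of length at least 3, not to a mere traversal of
      one edge back and forth.\<close>
    have "r \<noteq> []" using rs(2) no_loops'[OF xl] by (auto simp: awalk_Nil_iff)
    moreover have "length r \<noteq> 1"
      using rs(1,2) m_eq \<open>x \<noteq> v\<close> by (cases r) (auto simp: awalk_simps)
    ultimately have "3 \<le> length ((x, l) # r)" by (cases r rule: list_exhaust_NSC) auto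
    moreover have "cycle ((x, l) # r)"
      unfolding cycle_def using rs(2) xl r by (auto simp: awalk_Cons_iff apath_def intro!: exI[of _ x])
    ultimately show False using acyc by fastforce
  qed
  then show thesis using lv that by blast
qed

text \<open>In a symmetric graph, connectedness is reachability between all vertices, that is,
  finiteness of distances. In this form it passes to the tree without its leaf as soon as distances
  are known to be preserved.\<close>

lemma connected_iff_graph_dist:
  assumes "pair_graph G"
  shows "Digraph_Component.connected (with_proj G) \<longleftrightarrow>
    pverts G \<noteq> {} \<and> (\<forall>u\<in>pverts G. \<forall>v\<in>pverts G. graph_dist G u v \<noteq> \<infinity>)"
proof -
  interpret pair_graph G by fact
  have "mk_symmetric (with_proj G) = G"
    by (intro pair_pre_digraph.equality) (auto simp: parcs_mk_symmetric intro: arcs_symmetric)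
  moreover have "reachable (with_proj G) u v \<longleftrightarrow> graph_dist G u v \<noteq> \<infinity>" for u v
  proof -
    have "graph_dist G u v \<noteq> \<infinity> \<longleftrightarrow> graph_dist G u v < \<infinity>" by simp
    also have "\<dots> \<longleftrightarrow> (\<exists>p. apath u p v)" unfolding graph_dist_def INF_less_iff by simp
    finally show ?thesis by (simp add: reachable_apath)
  qed
  ultimately show ?thesis by (simp add: Digraph_Component.connected_def strongly_connected_def)
qed

section \<open>Removal of a leaf\<close>

context
  fixes T T' :: "'a pair_pre_digraph" and l v :: 'a
  assumes tree: "undirected_tree T" and lv: "(l, v) \<in> parcs T"
    and leaf: "\<And>x. (l, x) \<in> parcs T \<Longrightarrow> x = v"
  defines "T' \<equiv> \<lparr>pverts = pverts T - {l}, parcs = parcs T \<inter> (- {l}) \<times> (- {l})\<rparr>"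
begin

interpretation pair_graph T using tree by (simp add: undirected_tree_def)

lemma leaf_removed_pair_graph: "pair_graph T'"
  by (rule pair_graphI)
    (auto simp: T'_def pair_finite_verts irrefl_def sym_def
      dest: in_arcsD1 in_arcsD2 arcs_symmetric no_loops')

text \<open>Folding the leaf onto its neighbour sends every edge of \<open>T\<close> to an edge of
  \<open>T'\<close> or to a single vertex and fixes the vertices of \<open>T'\<close>, so no detour
  through \<open>l\<close> is a shortcut. The inclusion of \<open>T'\<close> gives the other
  inequality.\<close>

lemma leaf_removed_dist:
  assumes "a \<in> pverts T'" "b \<in> pverts T'"
  shows "graph_dist T' a b = graph_dist T a b"
proof (rule enat_eqI)
  fix k
  define h where "h x = (if x = l then v else x)" for x
  have vl: "v \<noteq> l" using lv no_loops' by blast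
  have ab: "a \<in> pverts T" "a \<noteq> l" "b \<noteq> l" using assms by (auto simp: T'_def)
  have "(a, b) \<in> ((parcs T)\<^sup>=) ^^ k" if "(a, b) \<in> ((parcs T')\<^sup>=) ^^ k"
    using relpow_nonexpansive[OF that, where h = id and S = "parcs T"] by (auto simp: T'_def)
  moreover have "(h x, h y) \<in> (parcs T')\<^sup>=" if "(x, y) \<in> parcs T" for x y
    using that leaf arcs_symmetric[OF that] vl by (auto simp: h_def T'_def)
  then have "(h a, h b) \<in> ((parcs T')\<^sup>=) ^^ k" if "(a, b) \<in> ((parcs T)\<^sup>=) ^^ k"
    using relpow_nonexpansive[OF that] by blast
  ultimately show "graph_dist T' a b \<le> enat k \<longleftrightarrow> graph_dist T a b \<le> enat k"
    using ab assms graph_dist_le_iff[OF pair_wf_digraph] 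
      graph_dist_le_iff[OF pair_graph_wf[OF leaf_removed_pair_graph]]
    by (auto simp: h_def)
qed

text \<open>Every walk from \<open>l\<close> to another vertex has to spend one step on reaching
  \<open>v\<close>. Hence the distance from \<open>l\<close> is one more than that from
  \<open>v\<close>; the formulation by bounds has the shape of
  \<open>complete_box_dist_le_iff\<close>, which makes the two directly comparable.\<close>

lemma leaf_dist_le_iff:
  assumes "b \<noteq> l"
  shows "graph_dist T l b \<le> enat k \<longleftrightarrow> (\<exists>k'. k = Suc k' \<and> graph_dist T v b \<le> enat k')"
proof -
  let ?R = "(parcs T)\<^sup>="
  have "(l, b) \<in> ?R ^^ k \<longleftrightarrow> (\<exists>k'. k = Suc k' \<and> (v, b) \<in> ?R ^^ k')"
  proof (induction k)
    case (Suc k)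
    \<comment> \<open>The first step idles at \<open>l\<close> or goes to \<open>v\<close>. In the
      idle case the induction hypothesis gives an even shorter walk from \<open>v\<close>, which is
      padded with an idle step.\<close>
    have "(v, b) \<in> ?R ^^ k" if "(l, b) \<in> ?R ^^ Suc k"
    proof -
      from that obtain y where y: "(l, y) \<in> ?R" "(y, b) \<in> ?R ^^ k"
        by (meson relpow_Suc_E2)
      then consider "y = l" | "y = v" using leaf by auto
      then show ?thesis
      proof cases
        case 1
        then show ?thesis using y Suc.IH relpow_reflcl_mono by (metis le_SucI order_refl)
      qed (use y in simp)
    qed
    then show ?case using lv by (auto intro: relpow_Suc_I2 simp del: relpow.simps)
  qed (use assms in simp)
  then show ?thesis
    using graph_dist_le_iff[OF pair_wf_digraph] lv in_arcsD1 in_arcsD2 by metis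
qed

text \<open>\<open>T'\<close> still contains \<open>v\<close>, its distances are those of
  \<open>T\<close> and so finite, and a cycle in a subgraph would be a cycle in
  \<open>T\<close>.\<close>

lemma leaf_removed_undirected_tree: "undirected_tree T'"
proof -
  interpret T': pair_graph T' by (rule leaf_removed_pair_graph)
  have "v \<in> pverts T'" using lv in_arcsD2 no_loops' by (auto simp: T'_def)
  then have "Digraph_Component.connected (with_proj T')"
    using tree leaf_removed_dist connected_iff_graph_dist[OF pair_graph]
      connected_iff_graph_dist[OF leaf_removed_pair_graph]
    by (auto simp: undirected_tree_def T'_def)
  moreover have "subgraph (with_proj T') (with_proj T)"
    using T'.wf_digraph_axioms wf_digraph_axioms
    by (auto simp: subgraph_def T'_def compatible_def)
  ultimately show ?thesis
    using tree subgraph_cycle leaf_removed_pair_graph by (auto simp: undirected_tree_def)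
qed

end

section \<open>Cartesian products with complete graphs\<close>

text \<open>The Cartesian product of the complete graph on \<open>{..<m}\<close> with
  \<open>G\<close>; the first coordinate numbers the layers.\<close>

definition complete_box :: "nat \<Rightarrow> 'a pair_pre_digraph \<Rightarrow> (nat \<times> 'a) pair_pre_digraph" where
  "complete_box m G = \<lparr>pverts = {..<m} \<times> pverts G,
     parcs = {((i, x), (j, y)) | i x j y. i < m \<and> j < m \<and> x \<in> pverts G \<and> y \<in> pverts G \<and>
       (if i = j then (x, y) \<in> parcs G else x = y)}\<rparr>"

lemma pverts_complete_box [simp]: "pverts (complete_box m G) = {..<m} \<times> pverts G"
  by (simp add: complete_box_def)

lemma parcs_complete_box_iff [simp]:
  "((i, x), (j, y)) \<in> parcs (complete_box m G) \<longleftrightarrow>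
     i < m \<and> j < m \<and> x \<in> pverts G \<and> y \<in> pverts G \<and> (if i = j then (x, y) \<in> parcs G else x = y)"
  by (auto simp: complete_box_def)

lemma pair_graph_complete_box:
  assumes "pair_graph G"
  shows "pair_graph (complete_box m G)"
proof -
  interpret pair_graph G by fact
  show ?thesis
    by (rule pair_graphI)
      (auto simp: pair_finite_verts irrefl_def sym_def arcs_symmetric split: if_splits dest: no_loops')
qed

text \<open>A walk in the product projects to \<open>G\<close>, where each change of layer becomes
  an idle step. Thus different layers cost at least one extra step, and a single change
  suffices.\<close>

lemma complete_box_dist_le_iff:
  assumes "pair_graph G" "i < m" "j < m" "x \<in> pverts G" "y \<in> pverts G"
  shows "graph_dist (complete_box m G) (i, x) (j, y) \<le> enat k \<longleftrightarrow>
    (if i = j then graph_dist G x y \<le> enat k else \<exists>k'. k = Suc k' \<and> graph_dist G x y \<le> enat k')"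
proof -
  interpret pair_graph G by fact
  let ?R = "(parcs G)\<^sup>=" and ?B = "(parcs (complete_box m G))\<^sup>="
  have layer: "((a, x), (a, z)) \<in> ?B ^^ k" if "(x, z) \<in> ?R ^^ k" "a < m" for a z k
    using relpow_nonexpansive[OF that(1), where h = "Pair a" and S = "parcs (complete_box m G)"]
      that(2) in_arcsD1 in_arcsD2 by auto
  \<comment> \<open>The induction follows the last step of the walk. A change of layer leaves the
    projection in place, so it supplies the spare step demanded when \<open>a\<close> differs from
    \<open>i\<close>.\<close>
  have proj: "if a = i then (x, z) \<in> ?R ^^ k else \<exists>k'. k = Suc k' \<and> (x, z) \<in> ?R ^^ k'"
    if "((i, x), (a, z)) \<in> ?B ^^ k" for a z k
    using that
  proof (induction k arbitrary: a z)
    case (Suc k)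
    then obtain c w where cw: "((i, x), (c, w)) \<in> ?B ^^ k" "((c, w), (a, z)) \<in> ?B" by auto
    note IH = Suc.IH[OF cw(1)]
    show ?case
    proof (cases "c = a")
      case True
      then have "(w, z) \<in> ?R" using cw(2) by (auto split: if_splits)
      then show ?thesis using IH True by (auto split: if_splits intro!: relpow_Suc_I simp del: relpow.simps)
    next
      case False
      then have "w = z" using cw(2) by auto
      then show ?thesis using IH False
        by (auto split: if_splits simp del: relpow.simps intro: relpow_reflcl_mono)
    qed
  qed auto
  have "((i, x), (j, y)) \<in> ?B ^^ k \<longleftrightarrow>
    (if i = j then (x, y) \<in> ?R ^^ k else \<exists>k'. k = Suc k' \<and> (x, y) \<in> ?R ^^ k')"
  proof (cases "i = j")
    case True
    then show ?thesis using proj[of j y k] layer assms by auto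
  next
    case False
    \<comment> \<open>Walk to \<open>y\<close> inside layer \<open>i\<close>, then change to layer
      \<open>j\<close>.\<close>
    have "((i, x), (j, y)) \<in> ?B ^^ Suc k'" if "(x, y) \<in> ?R ^^ k'" for k'
      using layer[OF that \<open>i < m\<close>] False assms by (intro relpow_Suc_I) auto
    then show ?thesis using False proj[of j y k] by (auto simp del: relpow.simps)
  qed
  then show ?thesis
    using assms graph_dist_le_iff[OF pair_wf_digraph]
      graph_dist_le_iff[OF pair_graph_wf[OF pair_graph_complete_box[OF assms(1)]], of "(i, x)" m]
    by auto
qed

section \<open>Extending a copy of a tree by a leaf\<close>

lemma arrows_complete_box:
  fixes G :: "'a pair_pre_digraph" and H :: "'b pair_pre_digraph"
  assumes G: "pair_graph G" "arrows_class G (oriented_trees n :: 'b pair_pre_digraph set)"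
    and "n \<ge> 1" and H: "H \<in> oriented_trees (Suc n)" and N: "card (pverts G) = N"
  shows "complete_box (Suc N) G \<Rrightarrow> H"
proof -
  interpret G: pair_graph G by fact
  obtain T where T: "undirected_tree T" "orientation H T" and card: "card (pverts H) = Suc n"
    using H by (auto simp: oriented_trees_def)
  interpret T: pair_graph T using T(1) by (simp add: undirected_tree_def)
  have verts: "pverts H = pverts T" using T(2) by (simp add: orientation_def)
  \<comment> \<open>A leaf exists because \<open>n \<ge> 1\<close> gives the tree at least two
    vertices.\<close>
  obtain l v where lv: "(l, v) \<in> parcs T" and leaf: "\<And>x. (l, x) \<in> parcs T \<Longrightarrow> x = v"
    using undirected_tree_leaf T(1) verts card \<open>n \<ge> 1\<close> by (metis One_nat_def Suc_1 Suc_le_mono)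
  define T' where "T' = \<lparr>pverts = pverts T - {l}, parcs = parcs T \<inter> (- {l}) \<times> (- {l})\<rparr>"
  define H' where "H' = \<lparr>pverts = pverts H - {l}, parcs = parcs H \<inter> (- {l}) \<times> (- {l})\<rparr>"
  have T': "undirected_tree T'" "pair_graph T'"
    using leaf_removed_undirected_tree[OF T(1) lv leaf] leaf_removed_pair_graph[OF T(1) lv leaf]
    by (auto simp: T'_def)
  have dist': "graph_dist T' a b = graph_dist T a b" if "a \<in> pverts T'" "b \<in> pverts T'" for a b
    using leaf_removed_dist[OF T(1) lv leaf] that by (simp add: T'_def)
  have HT': "orientation H' T'"
    using T(2) by (auto simp: orientation_def H'_def T'_def)
  have l: "l \<in> pverts H" and v: "v \<in> pverts H'"
    using T.in_arcsD1[OF lv] T.in_arcsD2[OF lv] T.no_loops'[OF lv] by (auto simp: verts H'_def)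
  have H': "H' \<in> oriented_trees n"
    using T' HT' card l by (auto simp: oriented_trees_def H'_def)
  have dist_H: "digraph_dist H = graph_dist T" and dist_H': "digraph_dist H' = graph_dist T'"
    using orientation_pair_digraph(3) T T.pair_graph T' HT' by (auto simp: digraph_dist_def)
  show ?thesis
    unfolding arrows_def
  proof (intro allI impI)
    fix D
    let ?P = "complete_box (Suc N) G"
    assume D: "orientation D ?P"
    \<comment> \<open>Arcs are read in layer \<open>i\<close> of \<open>D\<close>, but distances in
      \<open>G\<close>: the comparison with distances in the product is postponed to
      \<open>layer_dist\<close>.\<close>
    define copy where "copy i f \<longleftrightarrow> f ` pverts H' \<subseteq> pverts G \<and> inj_on f (pverts H') \<and>
      (\<forall>u\<in>pverts H'. \<forall>w\<in>pverts H'. (u, w) \<in> parcs H' \<longleftrightarrow> ((i, f u), (i, f w)) \<in> parcs D) \<and>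
      (\<forall>u\<in>pverts H'. \<forall>w\<in>pverts H'. graph_dist T' u w = graph_dist G (f u) (f w))"
      for i :: nat and f
    have "\<exists>f. copy i f" if "i \<le> N" for i
    proof -
      let ?D = "\<lparr>pverts = pverts G,
        parcs = {(x, y). x \<in> pverts G \<and> y \<in> pverts G \<and> ((i, x), (i, y)) \<in> parcs D}\<rparr>"
      have "orientation ?D G"
        using that by (intro orientation_pullback[OF D, where h = "Pair i"] G.pair_wf_digraph) simp
      moreover have "G \<Rrightarrow> H'" using G(2) H' by (simp add: arrows_class_def)
      ultimately obtain f where "f ` pverts H' \<subseteq> pverts G" "inj_on f (pverts H')"
        "\<forall>u\<in>pverts H'. \<forall>w\<in>pverts H'. (u, w) \<in> parcs H' \<longleftrightarrow> (f u, f w) \<in> parcs ?D"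
        "\<forall>u\<in>pverts H'. \<forall>w\<in>pverts H'. digraph_dist H' u w = graph_dist G (f u) (f w)"
        unfolding arrows_def by blast
      then have "copy i f" by (auto simp: copy_def dist_H' image_subset_iff)
      then show ?thesis by blast
    qed
    then obtain f where "\<And>i. i \<le> N \<Longrightarrow> copy i (f i)" by metis
    then have
      f_verts: "\<And>i u. i \<le> N \<Longrightarrow> u \<in> pverts H' \<Longrightarrow> f i u \<in> pverts G" and
      f_inj: "\<And>i. i \<le> N \<Longrightarrow> inj_on (f i) (pverts H')" and
      f_arcs: "\<And>i u w. i \<le> N \<Longrightarrow> u \<in> pverts H' \<Longrightarrow> w \<in> pverts H' \<Longrightarrow>
        (u, w) \<in> parcs H' \<longleftrightarrow> ((i, f i u), (i, f i w)) \<in> parcs D" and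
      f_dist: "\<And>i u w. i \<le> N \<Longrightarrow> u \<in> pverts H' \<Longrightarrow> w \<in> pverts H' \<Longrightarrow>
        graph_dist T' u w = graph_dist G (f i u) (f i w)"
      by (simp_all add: copy_def image_subset_iff)
    \<comment> \<open>There are \<open>N + 1\<close> layers but only \<open>N\<close> possible
      images of \<open>v\<close> in \<open>G\<close>.\<close>
    have "\<not> inj_on (\<lambda>i. f i v) {..N}"
    proof
      assume "inj_on (\<lambda>i. f i v) {..N}"
      then have "card {..N} \<le> card (pverts G)"
        using f_verts v G.pair_finite_verts by (intro card_inj_on_le) auto
      then show False using N by simp
    qed
    then obtain a b where ab: "a \<le> N" "b \<le> N" "a \<noteq> b" "f a v = f b v"
      by (auto simp: inj_on_def)
    define x where "x = f a v"
    have x: "x \<in> pverts G" using f_verts ab v by (simp add: x_def)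
    have anti: "((j, x), (i, x)) \<in> parcs D \<longleftrightarrow> ((i, x), (j, x)) \<notin> parcs D"
      if "i \<le> N" "j \<le> N" "i \<noteq> j" for i j
      using that x by (intro orientation_opposite[OF D]) simp
    \<comment> \<open>Layer \<open>i\<close> carries the copy of \<open>H'\<close> and layer
      \<open>j\<close> receives the leaf. Swapping the roles of \<open>a\<close> and
      \<open>b\<close> reverses the arc between the two vertices over \<open>x\<close>, so one of
      the two assignments fits.\<close>
    obtain i j where ij: "i \<le> N" "j \<le> N" "i \<noteq> j" "f i v = x"
      and arc: "((j, x), (i, x)) \<in> parcs D \<longleftrightarrow> (l, v) \<in> parcs H"
      using anti[OF ab(1-3)] ab x_def by metis
    define g where "g u = (if u = l then (j, x) else (i, f i u))" for u
    have D_sub: "(p, q) \<in> parcs ?P" if "(p, q) \<in> parcs D" for p q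
      using D that by (rule orientation_parcsD)
    have H_sub: "(p, q) \<in> parcs T" if "(p, q) \<in> parcs H" for p q
      using T(2) that by (rule orientation_parcsD)
    have g_verts: "g ` pverts H \<subseteq> pverts ?P"
      using f_verts ij x by (auto simp: g_def H'_def)
    have g_inj: "inj_on g (pverts H)"
      using f_inj[OF ij(1)] ij(3) by (auto simp: g_def H'_def inj_on_def)
    have fx: "f i u = x \<longleftrightarrow> u = v" if "u \<in> pverts H'" for u
      using f_inj[OF ij(1)] that v ij(4) by (auto simp: inj_on_def)
    \<comment> \<open>At \<open>v\<close> the direction is right by the choice of \<open>i\<close>
      and \<open>j\<close>. At any other \<open>u\<close> there is no arc on either side:
      \<open>l\<close> is a leaf, and different layers are joined only over equal vertices, while
      \<open>f i u = x\<close> forces \<open>u = v\<close>.\<close>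
    have leaf_arcs: "((l, u) \<in> parcs H \<longleftrightarrow> ((j, x), (i, f i u)) \<in> parcs D) \<and>
        ((u, l) \<in> parcs H \<longleftrightarrow> ((i, f i u), (j, x)) \<in> parcs D)" if "u \<in> pverts H'" for u
    proof (cases "u = v")
      case True
      moreover have "(v, l) \<in> parcs H \<longleftrightarrow> (l, v) \<notin> parcs H"
        using T.arcs_symmetric[OF lv] by (rule orientation_opposite[OF T(2)])
      ultimately show ?thesis using arc ij(4) anti[OF ij(1-3)] by metis
    next
      case False
      then have "((j, x), (i, f i u)) \<notin> parcs D" "((i, f i u), (j, x)) \<notin> parcs D"
        using D_sub fx[OF that] ij(3) by fastforce+
      moreover have "(l, u) \<notin> parcs H" "(u, l) \<notin> parcs H"
        using H_sub leaf T.arcs_symmetric False by blast+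
      ultimately show ?thesis by blast
    qed
    have "(l, l) \<notin> parcs H" "((j, x), (j, x)) \<notin> parcs D"
      using H_sub T.no_loops' D_sub G.no_loops' by fastforce+
    then have g_arcs: "(u, w) \<in> parcs H \<longleftrightarrow> (g u, g w) \<in> parcs D"
      if "u \<in> pverts H" "w \<in> pverts H" for u w
      using that leaf_arcs f_arcs[OF ij(1)] by (auto simp: g_def H'_def)
    \<comment> \<open>Both distances are one more than equal ones, from \<open>v\<close> in
      \<open>T\<close> and from \<open>x\<close> in \<open>G\<close>.\<close>
    have leaf_dist: "graph_dist T l u = graph_dist ?P (j, x) (i, f i u)" if u: "u \<in> pverts H'" for u
    proof (rule enat_eqI)
      fix k
      have "graph_dist T v u = graph_dist G x (f i u)"
        using dist' f_dist[OF ij(1) v u] ij(4) u v verts by (simp add: T'_def H'_def)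
      then show "graph_dist T l u \<le> enat k \<longleftrightarrow> graph_dist ?P (j, x) (i, f i u) \<le> enat k"
        using leaf_dist_le_iff[OF T(1) lv leaf] u ij x f_verts[OF ij(1) u]
          complete_box_dist_le_iff[OF G(1), of j "Suc N" i x "f i u" k]
        by (auto simp: H'_def)
    qed
    have layer_dist: "graph_dist T u w = graph_dist ?P (i, f i u) (i, f i w)"
      if "u \<in> pverts H'" "w \<in> pverts H'" for u w
    proof -
      have "graph_dist T u w = graph_dist G (f i u) (f i w)"
        using dist' f_dist[OF ij(1) that] that verts by (simp add: T'_def H'_def)
      also have "\<dots> = graph_dist ?P (i, f i u) (i, f i w)"
        using complete_box_dist_le_iff[OF G(1)] ij f_verts that by (intro enat_eqI) auto
      finally show ?thesis .
    qed
    have "graph_dist T l l = graph_dist ?P (j, x) (j, x)"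
      using ij x l verts by (simp add: graph_dist_refl)
    moreover have "graph_dist T u l = graph_dist ?P (i, f i u) (j, x)" if u: "u \<in> pverts H'" for u
      using leaf_dist[OF u] u l verts ij x f_verts
        graph_dist_commute[OF T.pair_graph, of u l]
        graph_dist_commute[OF pair_graph_complete_box[OF G(1)], of "(i, f i u)" "Suc N" "(j, x)"]
      by (auto simp: H'_def)
    ultimately have g_dist: "graph_dist T u w = graph_dist ?P (g u) (g w)"
      if "u \<in> pverts H" "w \<in> pverts H" for u w
      using that leaf_dist layer_dist by (auto simp: g_def H'_def)
    show "\<exists>f. f ` pverts H \<subseteq> pverts ?P \<and> inj_on f (pverts H) \<and>
        (\<forall>u\<in>pverts H. \<forall>v\<in>pverts H. (u, v) \<in> parcs H \<longleftrightarrow> (f u, f v) \<in> parcs D) \<and>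
        (\<forall>u\<in>pverts H. \<forall>v\<in>pverts H. digraph_dist H u v = graph_dist ?P (f u) (f v))"
      unfolding dist_H using g_verts g_inj g_arcs g_dist by blast
  qed
qed

section \<open>Bounds on the isometric Ramsey number\<close>

text \<open>\<open>IR\<close> ranges over graphs on natural numbers. Renaming the vertices by an
  injection \<open>h\<close> lets the product, whose vertices are pairs, serve as a witness.\<close>

lemma IR_le:
  fixes G :: "'a pair_pre_digraph"
  assumes G: "pair_graph G" "arrows_class G \<H>"
  shows "IR \<H> \<le> enat (card (pverts G))"
proof -
  interpret G: pair_graph G by fact
  obtain h :: "'a \<Rightarrow> nat" where h: "inj_on h (pverts G)"
    using finite_imp_inj_to_nat_seg[OF G.pair_finite_verts] by blast
  define K where "K = \<lparr>pverts = h ` pverts G, parcs = map_prod h h ` parcs G\<rparr>"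
  have K_verts: "pverts K = h ` pverts G" by (simp add: K_def)
  have K_arcs: "(h x, h y) \<in> parcs K \<longleftrightarrow> (x, y) \<in> parcs G" if "x \<in> pverts G" "y \<in> pverts G" for x y
  proof
    assume "(h x, h y) \<in> parcs K"
    then obtain x' y' where "(x', y') \<in> parcs G" "h x = h x'" "h y = h y'" by (auto simp: K_def)
    then show "(x, y) \<in> parcs G"
      using inj_onD[OF h] that G.in_arcsD1 G.in_arcsD2 by metis
  qed (force simp: K_def)
  have K_arcsE: "\<exists>x y. p = h x \<and> q = h y \<and> (x, y) \<in> parcs G" if "(p, q) \<in> parcs K" for p q
    using that by (auto simp: K_def)
  have K: "pair_graph K"
  proof (rule pair_graphI)
    show "parcs K \<subseteq> pverts K \<times> pverts K"
      by (auto simp: K_def dest: G.in_arcsD1 G.in_arcsD2)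
    show "sym (parcs K)"
      by (rule symI) (metis K_arcsE K_arcs G.arcs_symmetric G.in_arcsD1 G.in_arcsD2)
    show "irrefl (parcs K)"
      unfolding irrefl_def by (metis K_arcsE K_arcs G.no_loops' G.in_arcsD1 G.in_arcsD2)
  qed (simp add: K_verts G.pair_finite_verts)
  have dist: "graph_dist K (h x) (h y) = graph_dist G x y" if "x \<in> pverts G" "y \<in> pverts G" for x y
  proof (rule enat_eqI)
    fix k
    \<comment> \<open>Neither \<open>h\<close> nor its inverse increases distances, so both preserve
      them.\<close>
    let ?h = "the_inv_into (pverts G) h"
    have "(h x, h y) \<in> ((parcs K)\<^sup>=) ^^ k" if "(x, y) \<in> ((parcs G)\<^sup>=) ^^ k"
      using relpow_nonexpansive[OF that, of h "parcs K"] by (force simp: K_def)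
    moreover have "(?h (h x), ?h (h y)) \<in> ((parcs G)\<^sup>=) ^^ k" if "(h x, h y) \<in> ((parcs K)\<^sup>=) ^^ k"
      using that
    proof (rule relpow_nonexpansive)
      show "(?h p, ?h q) \<in> (parcs G)\<^sup>=" if "(p, q) \<in> parcs K" for p q
        using that G.in_arcsD1 G.in_arcsD2 by (auto simp: K_def the_inv_into_f_f[OF h])
    qed
    ultimately show "graph_dist K (h x) (h y) \<le> enat k \<longleftrightarrow> graph_dist G x y \<le> enat k"
      using that graph_dist_le_iff[OF G.pair_wf_digraph that(1)]
        graph_dist_le_iff[OF pair_graph_wf[OF K], of "h x"]
      by (auto simp: K_verts the_inv_into_f_f[OF h])
  qed
  have "K \<Rrightarrow> H" if "H \<in> \<H>" for H
    unfolding arrows_def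
  proof (intro allI impI)
    fix D assume D: "orientation D K"
    let ?D = "\<lparr>pverts = pverts G, parcs = {(x, y). x \<in> pverts G \<and> y \<in> pverts G \<and> (h x, h y) \<in> parcs D}\<rparr>"
    have "orientation ?D G"
      by (rule orientation_pullback[OF D K_arcs G.pair_wf_digraph])
    moreover have "G \<Rrightarrow> H" using G(2) that by (simp add: arrows_class_def)
    ultimately obtain f where f: "f ` pverts H \<subseteq> pverts G" "inj_on f (pverts H)"
      "\<forall>u\<in>pverts H. \<forall>v\<in>pverts H. (u, v) \<in> parcs H \<longleftrightarrow> (f u, f v) \<in> parcs ?D"
      "\<forall>u\<in>pverts H. \<forall>v\<in>pverts H. digraph_dist H u v = graph_dist G (f u) (f v)"
      unfolding arrows_def by blast
    then have f_arcs: "\<forall>u\<in>pverts H. \<forall>v\<in>pverts H. (u, v) \<in> parcs H \<longleftrightarrow> (h (f u), h (f v)) \<in> parcs D"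
      by auto
    show "\<exists>f. f ` pverts H \<subseteq> pverts K \<and> inj_on f (pverts H) \<and>
        (\<forall>u\<in>pverts H. \<forall>v\<in>pverts H. (u, v) \<in> parcs H \<longleftrightarrow> (f u, f v) \<in> parcs D) \<and>
        (\<forall>u\<in>pverts H. \<forall>v\<in>pverts H. digraph_dist H u v = graph_dist K (f u) (f v))"
    proof (intro exI[of _ "h \<circ> f"] conjI)
      show "inj_on (h \<circ> f) (pverts H)" using f(1,2) h by (meson comp_inj_on inj_on_subset)
    qed (use f(1,4) f_arcs dist in \<open>auto simp: K_verts image_subset_iff\<close>)
  qed
  then have "IR \<H> \<le> enat (card (pverts K))"
    unfolding IR_def using K by (intro INF_lower) (simp add: arrows_class_def)
  then show ?thesis using h by (simp add: K_verts card_image)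
qed

lemma IR_oriented_trees_1: "IR (oriented_trees 1) \<le> 1"
proof -
  define G :: "nat pair_pre_digraph" where "G = \<lparr>pverts = {0}, parcs = {}\<rparr>"
  have "G \<Rrightarrow> H" if H: "H \<in> oriented_trees 1" for H :: "nat pair_pre_digraph"
    unfolding arrows_def
  proof (intro allI impI)
    fix D assume D: "orientation D G"
    obtain T a where T: "undirected_tree T" "orientation H T" and a: "pverts H = {a}"
      using H by (auto simp: oriented_trees_def card_1_singleton_iff)
    interpret T: pair_graph T using T(1) by (simp add: undirected_tree_def)
    have "(a, a) \<notin> parcs H" using orientation_parcsD[OF T(2)] T.no_loops' by blast
    moreover have "a \<in> pverts T" using T(2) a unfolding orientation_def by blast
    moreover have "digraph_dist H = graph_dist T"
      using orientation_pair_digraph(3)[OF T.pair_graph T(2)] by (simp add: digraph_dist_def)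
    ultimately show "\<exists>f. f ` pverts H \<subseteq> pverts G \<and> inj_on f (pverts H) \<and>
        (\<forall>u\<in>pverts H. \<forall>v\<in>pverts H. (u, v) \<in> parcs H \<longleftrightarrow> (f u, f v) \<in> parcs D) \<and>
        (\<forall>u\<in>pverts H. \<forall>v\<in>pverts H. digraph_dist H u v = graph_dist G (f u) (f v))"
      using D a by (intro exI[of _ "\<lambda>_. 0"]) (auto simp: G_def graph_dist_refl dest: orientation_parcsD[OF D])
  qed
  moreover have "pair_graph G"
    by (rule pair_graphI) (auto simp: G_def irrefl_def sym_def)
  ultimately show ?thesis
    using IR_le[of G "oriented_trees 1"] by (simp add: arrows_class_def G_def one_enat_def)
qed

text \<open>The product has one layer more than \<open>G\<close> has vertices. A bound
  \<open>N\<close> in place of the exact value suits the induction, as \<open>N * (N + 1)\<close> is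
  monotone in \<open>N\<close>.\<close>

lemma IR_oriented_trees_Suc:
  assumes "n \<ge> 1" "IR (oriented_trees n) \<le> enat N"
  shows "IR (oriented_trees (Suc n)) \<le> enat (N * (N + 1))"
proof -
  have "IR (oriented_trees n) < enat (Suc N)"
    using assms(2) enat_ord_simps(2) lessI order_le_less_trans by blast
  then obtain G :: "nat pair_pre_digraph" where
    G: "pair_graph G" "arrows_class G (oriented_trees n :: nat pair_pre_digraph set)"
    and N: "card (pverts G) \<le> N"
    by (auto simp: IR_def INF_less_iff)
  let ?M = "card (pverts G)"
  have "IR (oriented_trees (Suc n)) \<le> enat (card (pverts (complete_box (Suc ?M) G)))"
    using arrows_complete_box[OF G \<open>n \<ge> 1\<close>] pair_graph_complete_box[OF G(1)]
    by (intro IR_le) (auto simp: arrows_class_def)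
  also have "\<dots> = enat (?M * (?M + 1))" by (simp add: card_cartesian_product algebra_simps)
  also have "\<dots> \<le> enat (N * (N + 1))" using N by (simp only: enat_ord_simps) (intro mult_le_mono add_right_mono)
  finally show ?thesis .
qed

text \<open>Keeping the gap of one below the double power closes the recurrence: for
  \<open>M = 2 ^ 2 ^ n\<close>, \<open>(M - 1) * M \<le> M * M - 1\<close>. The bound
  \<open>M\<close> itself would only lead to \<open>M * (M + 1)\<close>, which exceeds
  \<open>M * M\<close>.\<close>

lemma IR_oriented_trees_bound: "IR (oriented_trees (Suc n)) \<le> enat (2 ^ 2 ^ n - 1)"
proof (induction n)
  case 0
  then show ?case using IR_oriented_trees_1 by (simp add: one_enat_def)
next
  case (Suc n)
  let ?M = "2 ^ 2 ^ n :: nat"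
  have "IR (oriented_trees (Suc (Suc n))) \<le> enat ((?M - 1) * (?M - 1 + 1))"
    using Suc by (intro IR_oriented_trees_Suc) auto
  also have "(?M - 1) * (?M - 1 + 1) \<le> ?M * ?M - 1" by (simp add: diff_mult_distrib diff_le_mono2)
  also have "?M * ?M = 2 ^ 2 ^ Suc n" by (simp add: power_add[symmetric] mult_2)
  finally show ?case by simp
qed

theorem theorem3p3:
  fixes n :: nat
  assumes "n \<ge> 1"
  shows "IR (oriented_trees (n + 1)) \<le> IR (oriented_trees n) * (IR (oriented_trees n) + 1)
       \<and> IR (oriented_trees n) < enat (2 ^ (2 ^ (n - 1)))"
proof
  have bound: "IR (oriented_trees n) \<le> enat (2 ^ 2 ^ (n - 1) - 1)"
    using IR_oriented_trees_bound[of "n - 1"] assms by simp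
  \<comment> \<open>The bound shows that the value is finite, so the product in \<open>enat\<close>
    is one of natural numbers.\<close>
  then obtain N where "IR (oriented_trees n) = enat N" by (auto dest: enat_ile)
  then show "IR (oriented_trees (n + 1)) \<le> IR (oriented_trees n) * (IR (oriented_trees n) + 1)"
    using IR_oriented_trees_Suc[OF assms, of N] by (simp add: one_enat_def)
  show "IR (oriented_trees n) < enat (2 ^ (2 ^ (n - 1)))"
    using bound by (rule le_less_trans) simp
qed

end
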